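(* The following statements are true. (i) $\mathcal{O}dd=\mathcal{GP}\cap\mathcal{O}dd$. (ii) A rational function $\psi$ is in $\mathcal{O}dd$ if and only if $\psi$ maps the imaginary axis to itself. (iii) The set $\mathcal{O}dd$ is closed (excluding the zero function) under: (a) real scaling, (b) addition, (c) inversion, (d) composition (whenever defined), and (e) the product of an odd number of elements, i.e. $\prod_{j=1}^{2m+1}\psi_j(s)\in\mathcal{O}dd$ whenever $\psi_j\in\mathcal{O}dd$, $m=0,1,\ldots$ (iv) Every $\psi\in\mathcal{O}dd$ can be written as $$\psi(s)=g(s)\left(ir_o+a_os+\sum_{j\ge1}\frac{a_j}{s-ir_j}\right)g^{\#}(s)$$ (a finite, possibly empty, sum), with $r_o\in\mathbb{R}$, $a_o\ge0$, $a_j>0$, $r_j\in\mathbb{R}$ and $g\in\overline{\mathcal{G}_+}$.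
   Context: All functions are scalar rational functions of a complex variable $s$ with complex coefficients. For a rational function $f$, $f^{\#}(s):=(f(-s^* ))^*$, where $^*$ is complex conjugation. $\mathcal{O}dd$ is the set of rational functions $f$ with $f=f_{\rm odd}$, where $f_{\rm odd}(s):=\tfrac12(f(s)-f^{\#}(s))$; equivalently $f^{\#}=-f$. $\mathcal{GP}$ (generalized positive functions) is the set of rational functions $\psi$ with $\operatorname{Re}\psi(s)\ge0$ for all $s\in i\mathbb{R}$ which are not poles of $\psi$. "Maps the imaginary axis to itself" means $\psi(s)\in i\mathbb{R}$ for every $s\in i\mathbb{R}$ which is not a pole of $\psi$. $\overline{\mathcal{G}_+}$ is the set of nonzero rational functions $g$ such that both $g$ and $g^{-1}$ are analytic in the open left half plane $\mathbb{C}_-=\{\operatorname{Re}s<0\}$. *)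

theory Defs
  imports "HOL-Complex_Analysis.Complex_Analysis"
    "HOL-Computational_Algebra.Computational_Algebra"
    "HOL-Computational_Algebra.Field_as_Ring"
begin

type_synonym rat_fun = "complex poly fract"

definition rf_const :: "complex \<Rightarrow> rat_fun"
  where "rf_const c = to_fract [:c:]"

definition rf_var :: rat_fun
  where "rf_var = to_fract [:0, 1:]"

text \<open>The numerator and denominator given by \<^const>\<open>quot_of_fract\<close> are coprime, so only at a
  genuine pole is this a division by \<open>0\<close> (with junk value \<open>0\<close>).\<close>

definition rf_eval :: "rat_fun \<Rightarrow> complex \<Rightarrow> complex"
  where "rf_eval f s = poly (fst (quot_of_fract f)) s / poly (snd (quot_of_fract f)) s"

abbreviation rf_pole :: "rat_fun \<Rightarrow> complex \<Rightarrow> bool"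
  where "rf_pole f s \<equiv> is_pole (rf_eval f) s"

lemma rf_denominator_zero_imp_numerator_nonzero:
  fixes f :: rat_fun
  assumes "poly (snd (quot_of_fract f)) s = 0"
  shows "poly (fst (quot_of_fract f)) s \<noteq> 0"
  using coprime_poly_0[OF coprime_quot_of_fract[of f], of s] assms by auto

lemma rf_pole_iff: "rf_pole f s \<longleftrightarrow> poly (snd (quot_of_fract f)) s = 0"
proof -
  define p q where "p = fst (quot_of_fract f)" and "q = snd (quot_of_fract f)"
  have q: "q \<noteq> 0" by (simp add: q_def)
  have ev: "rf_eval f = (\<lambda>s. poly p s / poly q s)"
    by (simp add: rf_eval_def p_def q_def fun_eq_iff)
  show ?thesis
  proof (cases "poly q s = 0")
    case True
    have p: "poly p s \<noteq> 0"
      using rf_denominator_zero_imp_numerator_nonzero[of f s] True by (simp add: p_def q_def)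
    have "filterlim (poly q) (at 0) (at s)"
      unfolding filterlim_at
    proof
      show "\<forall>\<^sub>F x in at s. poly q x \<in> UNIV \<and> poly q x \<noteq> 0"
        using islimpt_finite[OF poly_roots_finite[OF q], of s]
        by (simp add: islimpt_conv_frequently_at frequently_def)
      show "(poly q \<longlongrightarrow> 0) (at s)"
        using isContD[OF poly_isCont[of s q]] True by simp
    qed
    hence "is_pole (\<lambda>s. poly p s / poly q s) s"
      using p by (intro is_pole_divide) auto
    thus ?thesis using True by (simp add: ev q_def)
  next
    case False
    hence "isCont (\<lambda>s. poly p s / poly q s) s" by (intro continuous_intros) auto
    hence "\<not> is_pole (\<lambda>s. poly p s / poly q s) s"
      unfolding is_pole_def
      using not_tendsto_and_filterlim_at_infinity[OF trivial_limit_at] isContD by blast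
    thus ?thesis using False by (simp add: ev q_def)
  qed
qed

lemma rf_eval_Fract:
  assumes "poly b s \<noteq> 0"
  shows "rf_eval (Fract a b) s = poly a s / poly b s" and "\<not> rf_pole (Fract a b) s"
proof -
  define p q where "p = fst (quot_of_fract (Fract a b))" and "q = snd (quot_of_fract (Fract a b))"
  have nz: "b \<noteq> 0" "q \<noteq> 0" using assms by (auto simp: q_def)
  have "Fract p q = Fract a b" by (simp add: p_def q_def)
  hence "p * b = a * q" using nz by (simp add: eq_fract)
  hence eq: "poly p s * poly b s = poly a s * poly q s" by (metis poly_mult)
  have q: "poly q s \<noteq> 0"
    using eq assms rf_denominator_zero_imp_numerator_nonzero[of "Fract a b" s]
    by (auto simp: p_def q_def)
  show "\<not> rf_pole (Fract a b) s" using q by (simp add: rf_pole_iff q_def)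
  show "rf_eval (Fract a b) s = poly a s / poly b s"
    using q eq assms by (simp add: rf_eval_def field_simps flip: p_def q_def)
qed

text \<open>For a polynomial \<open>p\<close>, the polynomial \<open>(p(-s\<^sup>*))\<^sup>*\<close> in \<open>s\<close>.\<close>

definition poly_sharp :: "complex poly \<Rightarrow> complex poly"
  where "poly_sharp p = pcompose (map_poly cnj p) [:0, -1:]"

definition rf_sharp :: "rat_fun \<Rightarrow> rat_fun"
  where "rf_sharp f = Fract (poly_sharp (fst (quot_of_fract f))) (poly_sharp (snd (quot_of_fract f)))"

lemma poly_poly_sharp: "poly (poly_sharp p) s = cnj (poly p (- cnj s))"
  by (simp add: poly_sharp_def poly_pcompose)

lemma rf_sharp_eval:
  assumes "\<not> rf_pole f (- cnj s)"
  shows "rf_eval (rf_sharp f) s = cnj (rf_eval f (- cnj s))"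
  using assms rf_eval_Fract(1)[of "poly_sharp (snd (quot_of_fract f))" s]
  by (simp add: rf_pole_iff rf_sharp_def poly_poly_sharp rf_eval_def)

text \<open>The composition \<open>f \<circ> g\<close> makes sense as a rational function unless \<open>g\<close> is constant with value
  a pole of \<open>f\<close>.\<close>

definition rf_comp_defined :: "rat_fun \<Rightarrow> rat_fun \<Rightarrow> bool"
  where "rf_comp_defined f g \<longleftrightarrow> (\<exists>s. \<not> rf_pole g s \<and> \<not> rf_pole f (rf_eval g s))"

definition rf_comp :: "rat_fun \<Rightarrow> rat_fun \<Rightarrow> rat_fun"
  where "rf_comp f g =
    poly (map_poly rf_const (fst (quot_of_fract f))) g /
    poly (map_poly rf_const (snd (quot_of_fract f))) g"

lemma rf_poly_subst:
  assumes "poly b s \<noteq> 0"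
  shows "\<exists>c d. poly (map_poly rf_const p) (Fract a b) = Fract c d \<and> poly d s \<noteq> 0 \<and>
    poly c s / poly d s = poly p (poly a s / poly b s)"
proof (induction p)
  case 0
  show ?case by (rule exI[of _ 0], rule exI[of _ 1]) (simp add: Zero_fract_def)
next
  case (pCons e p)
  obtain c d where cd: "poly (map_poly rf_const p) (Fract a b) = Fract c d" "poly d s \<noteq> 0"
    "poly c s / poly d s = poly p (poly a s / poly b s)"
    using pCons.IH by auto
  have nz: "b \<noteq> 0" "d \<noteq> 0" using assms cd(2) by auto
  have z: "rf_const 0 = 0" by (simp add: rf_const_def)
  have m: "map_poly rf_const (pCons e p) = pCons (rf_const e) (map_poly rf_const p)"
    by (rule poly_eqI) (auto simp: coeff_map_poly z coeff_pCons split: nat.splits)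
  have "poly (map_poly rf_const (pCons e p)) (Fract a b) =
      Fract ([:e:] * (b * d) + a * c) (b * d)"
    unfolding m poly_pCons cd(1) rf_const_def to_fract_def using nz by simp
  moreover have "poly (b * d) s \<noteq> 0" using assms cd(2) by simp
  moreover have "poly ([:e:] * (b * d) + a * c) s / poly (b * d) s =
      e + (poly a s / poly b s) * (poly c s / poly d s)"
    using assms cd(2) by (simp add: add_divide_distrib)
  hence "poly ([:e:] * (b * d) + a * c) s / poly (b * d) s =
      poly (pCons e p) (poly a s / poly b s)"
    unfolding cd(3) by simp
  ultimately show ?case by blast
qed

lemma rf_comp_eval:
  assumes "\<not> rf_pole g s" and "\<not> rf_pole f (rf_eval g s)"
  shows "rf_eval (rf_comp f g) s = rf_eval f (rf_eval g s)" and "\<not> rf_pole (rf_comp f g) s"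
proof -
  define a b where "a = fst (quot_of_fract g)" and "b = snd (quot_of_fract g)"
  define p q where "p = fst (quot_of_fract f)" and "q = snd (quot_of_fract f)"
  have b: "poly b s \<noteq> 0" using assms(1) by (simp add: rf_pole_iff b_def)
  have g: "g = Fract a b" by (simp add: a_def b_def)
  have e: "rf_eval g s = poly a s / poly b s" by (simp add: rf_eval_def a_def b_def)
  obtain c d where cd: "poly (map_poly rf_const p) g = Fract c d" "poly d s \<noteq> 0"
    "poly c s / poly d s = poly p (rf_eval g s)"
    using rf_poly_subst[OF b, of p a] unfolding e g[symmetric] by blast
  obtain c' d' where cd': "poly (map_poly rf_const q) g = Fract c' d'" "poly d' s \<noteq> 0"
    "poly c' s / poly d' s = poly q (rf_eval g s)"
    using rf_poly_subst[OF b, of q a] unfolding e g[symmetric] by blast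
  have "poly q (rf_eval g s) \<noteq> 0" using assms(2) by (simp add: rf_pole_iff q_def)
  hence c': "poly c' s \<noteq> 0" using cd' by auto
  have eq: "rf_comp f g = Fract (c * d') (d * c')"
    by (simp add: rf_comp_def cd cd' flip: p_def q_def)
  have nz: "poly (d * c') s \<noteq> 0" using c' cd(2) by simp
  show "\<not> rf_pole (rf_comp f g) s" unfolding eq by (rule rf_eval_Fract(2)[OF nz])
  have "rf_eval f (rf_eval g s) = (poly c s / poly d s) / (poly c' s / poly d' s)"
    unfolding cd(3) cd'(3) by (simp add: rf_eval_def p_def q_def)
  also have "\<dots> = rf_eval (rf_comp f g) s"
    unfolding eq rf_eval_Fract(1)[OF nz] by simp
  finally show "rf_eval (rf_comp f g) s = rf_eval f (rf_eval g s)" ..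
qed

definition rf_odd_part :: "rat_fun \<Rightarrow> rat_fun"
  where "rf_odd_part f = rf_const (1 / 2) * (f - rf_sharp f)"

definition Odd_rf :: "rat_fun set"
  where "Odd_rf = {f. f = rf_odd_part f}"

definition GP :: "rat_fun set"
  where "GP = {\<psi>. \<forall>s. Re s = 0 \<and> \<not> rf_pole \<psi> s \<longrightarrow> Re (rf_eval \<psi> s) \<ge> 0}"

definition maps_imaginary_axis_to_itself :: "rat_fun \<Rightarrow> bool"
  where "maps_imaginary_axis_to_itself \<psi> \<longleftrightarrow>
    (\<forall>s. Re s = 0 \<and> \<not> rf_pole \<psi> s \<longrightarrow> Re (rf_eval \<psi> s) = 0)"

definition G_plus_closure :: "rat_fun set"
  where "G_plus_closure = {g. g \<noteq> 0 \<and>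
    rf_eval g analytic_on {s. Re s < 0} \<and> rf_eval (inverse g) analytic_on {s. Re s < 0}}"

end

theory Submission
  imports Defs
begin

text \<open>Oddness of \<open>p / q\<close> is a polynomial identity, so it can be tested on the imaginary axis, where
  \<open>s \<mapsto> - s\<^sup>*\<close> is the identity and \<open>\<psi>\<^sup>#\<close> is the conjugate of \<open>\<psi>\<close>. The closure properties hold because
  \<open>\<psi> \<mapsto> \<psi>\<^sup>#\<close> is a field automorphism.

  For the factorization, factors \<open>h h\<^sup>#\<close> may be moved freely into \<open>g g\<^sup>#\<close>, since replacing a factor
  \<open>s - w\<close> of \<open>h\<close> by \<open>(s - w)\<^sup># = - (s + w\<^sup>*)\<close> does not change \<open>h h\<^sup>#\<close>. Writing
  \<open>p / q = p q\<^sup># / (q q\<^sup>#)\<close> and pairing roots, one is left with an odd polynomial having only simple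
  roots, all of them imaginary. Dividing by \<open>B B\<^sup>#\<close>, where \<open>B\<close> contains every other root, gives a
  rational function whose zeros and poles interlace on the imaginary axis, and its partial fraction
  expansion has the required positive coefficients.\<close>

subsection \<open>Odd rational functions\<close>

lemma poly_sharp_eq_iff: "poly_sharp p = q \<longleftrightarrow> (\<forall>s. poly q s = cnj (poly p (- cnj s)))"
  by (auto simp: poly_eq_poly_eq_iff[symmetric] fun_eq_iff poly_poly_sharp)

lemma poly_sharp_simps [simp]:
  "poly_sharp 0 = 0"
  "poly_sharp 1 = 1"
  "poly_sharp [:c:] = [:cnj c:]"
  "poly_sharp (p + q) = poly_sharp p + poly_sharp q"
  "poly_sharp (- p) = - poly_sharp p"
  "poly_sharp (p - q) = poly_sharp p - poly_sharp q"
  "poly_sharp (p * q) = poly_sharp p * poly_sharp q"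
  "poly_sharp (smult c p) = smult (cnj c) (poly_sharp p)"
  "poly_sharp (poly_sharp p) = p"
  by (simp_all add: poly_sharp_eq_iff poly_poly_sharp)

lemma poly_sharp_prod: "poly_sharp (\<Prod>x\<in>A. f x) = (\<Prod>x\<in>A. poly_sharp (f x))"
  by (simp add: poly_sharp_eq_iff poly_poly_sharp poly_prod)

lemma poly_sharp_linear: "poly_sharp [:- w, 1:] = - [:cnj w, 1:]"
  by (simp add: poly_sharp_eq_iff)

lemma poly_sharp_eq_0_iff [simp]: "poly_sharp p = 0 \<longleftrightarrow> p = 0"
  by (metis poly_sharp_simps(1,9))

text \<open>\<open>poly_sharp\<close> is multiplicative and thus preserves cross-multiplied
  equality, so any representative may replace the reduced fraction used in the definition.
  Additivity and multiplicativity of \<open>rf_sharp\<close> then follow by computing with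
  representatives.\<close>

lemma rf_sharp_Fract:
  assumes "b \<noteq> 0"
  shows "rf_sharp (Fract a b) = Fract (poly_sharp a) (poly_sharp b)"
proof -
  define p q where "p = fst (quot_of_fract (Fract a b))" and "q = snd (quot_of_fract (Fract a b))"
  have q: "q \<noteq> 0"
    by (simp add: q_def)
  have "Fract p q = Fract a b"
    by (simp add: p_def q_def)
  hence "p * b = a * q"
    using q assms by (simp add: eq_fract)
  hence "poly_sharp p * poly_sharp b = poly_sharp a * poly_sharp q"
    by (simp flip: poly_sharp_simps(7))
  thus ?thesis
    using q assms by (simp add: rf_sharp_def eq_fract flip: p_def q_def)
qed

lemma rf_sharp_to_fract: "rf_sharp (to_fract p) = to_fract (poly_sharp p)"
  by (simp add: to_fract_def rf_sharp_Fract)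

lemma rf_sharp_add [simp]: "rf_sharp (f + g) = rf_sharp f + rf_sharp g"
  by (cases f; cases g) (simp add: rf_sharp_Fract)

lemma rf_sharp_mult [simp]: "rf_sharp (f * g) = rf_sharp f * rf_sharp g"
  by (cases f; cases g) (simp add: rf_sharp_Fract)

lemma rf_sharp_uminus [simp]: "rf_sharp (- f) = - rf_sharp f"
  by (cases f) (simp add: rf_sharp_Fract)

lemma rf_sharp_diff [simp]: "rf_sharp (f - g) = rf_sharp f - rf_sharp g"
  using rf_sharp_add[of f "- g"] by simp

lemma rf_sharp_0 [simp]: "rf_sharp 0 = 0"
  using rf_sharp_to_fract[of 0] by simp

lemma rf_sharp_1 [simp]: "rf_sharp 1 = 1"
  using rf_sharp_to_fract[of 1] by simp

lemma rf_sharp_inverse [simp]: "rf_sharp (inverse f) = inverse (rf_sharp f)"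
proof (cases "f = 0")
  case False
  hence "rf_sharp f * rf_sharp (inverse f) = 1"
    by (simp flip: rf_sharp_mult)
  thus ?thesis
    by (simp add: inverse_unique)
qed simp

lemma rf_sharp_divide [simp]: "rf_sharp (f / g) = rf_sharp f / rf_sharp g"
  by (simp add: divide_inverse)

lemma rf_sharp_prod: "rf_sharp (\<Prod>x\<in>A. f x) = (\<Prod>x\<in>A. rf_sharp (f x))"
  by (induction A rule: infinite_finite_induct) auto

lemma rf_sharp_const [simp]: "rf_sharp (rf_const c) = rf_const (cnj c)"
  by (simp add: rf_const_def rf_sharp_to_fract)

lemma rf_sharp_var [simp]: "rf_sharp rf_var = - rf_var"
  using poly_sharp_linear[of 0] by (simp add: rf_var_def rf_sharp_to_fract flip: to_fract_uminus)

lemma rf_const_add: "rf_const (c + d) = rf_const c + rf_const d"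
  by (simp add: rf_const_def flip: to_fract_add)

lemma rf_const_uminus: "rf_const (- c) = - rf_const c"
  by (simp add: rf_const_def flip: to_fract_uminus)

lemma rf_const_mult: "rf_const (c * d) = rf_const c * rf_const d"
  by (simp add: rf_const_def flip: to_fract_mult)

lemma rf_const_0 [simp]: "rf_const 0 = 0"
  by (simp add: rf_const_def)

lemma rf_const_1 [simp]: "rf_const 1 = 1"
  by (simp add: rf_const_def flip: one_pCons)

lemma rf_const_eq_iff [simp]: "rf_const c = rf_const d \<longleftrightarrow> c = d"
  by (simp add: rf_const_def)

text \<open>Doubling the fixed-point equation for the odd part gives the form that the closure
  proofs use.\<close>

lemma Odd_rf_iff: "f \<in> Odd_rf \<longleftrightarrow> rf_sharp f = - f"
proof -
  have half: "rf_const (1 / 2) + rf_const (1 / 2) = 1"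
    by (simp flip: rf_const_add)
  show ?thesis
  proof
    assume "f \<in> Odd_rf"
    hence "f = rf_const (1 / 2) * (f - rf_sharp f)"
      by (simp add: Odd_rf_def rf_odd_part_def)
    hence "f + f = (rf_const (1 / 2) + rf_const (1 / 2)) * (f - rf_sharp f)"
      by (metis distrib_right)
    hence "f + f = f + (- rf_sharp f)"
      by (simp add: half)
    thus "rf_sharp f = - f"
      by (metis add_left_cancel minus_minus)
  next
    assume "rf_sharp f = - f"
    hence "rf_odd_part f = (rf_const (1 / 2) + rf_const (1 / 2)) * f"
      by (simp add: rf_odd_part_def algebra_simps)
    thus "f \<in> Odd_rf"
      by (simp add: Odd_rf_def half)
  qed
qed

lemma Odd_rf_Fract_iff:
  assumes "q \<noteq> 0"
  shows "Fract p q \<in> Odd_rf \<longleftrightarrow> poly_sharp p * q = - (p * poly_sharp q)"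
  using assms by (simp add: Odd_rf_iff rf_sharp_Fract eq_fract)

lemma Odd_rf_scale: "\<psi> \<in> Odd_rf \<Longrightarrow> rf_const (of_real c) * \<psi> \<in> Odd_rf"
  by (simp add: Odd_rf_iff)

lemma Odd_rf_add: "\<psi> \<in> Odd_rf \<Longrightarrow> \<phi> \<in> Odd_rf \<Longrightarrow> \<psi> + \<phi> \<in> Odd_rf"
  by (simp add: Odd_rf_iff)

lemma Odd_rf_sum: "(\<And>x. x \<in> A \<Longrightarrow> f x \<in> Odd_rf) \<Longrightarrow> (\<Sum>x\<in>A. f x) \<in> Odd_rf"
  by (induction A rule: infinite_finite_induct) (auto simp: Odd_rf_iff)

lemma Odd_rf_inverse: "\<psi> \<in> Odd_rf \<Longrightarrow> inverse \<psi> \<in> Odd_rf"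
  by (simp add: Odd_rf_iff)

text \<open>Each factor contributes one sign, and an odd number of signs leaves one. Odd cardinality
  also forces \<open>A\<close> to be finite.\<close>

lemma Odd_rf_prod:
  assumes "\<And>x. x \<in> A \<Longrightarrow> f x \<in> Odd_rf" and "odd (card A)"
  shows "(\<Prod>x\<in>A. f x) \<in> Odd_rf"
proof -
  have "rf_sharp (\<Prod>x\<in>A. f x) = (\<Prod>x\<in>A. - f x)"
    unfolding rf_sharp_prod using assms(1) by (intro prod.cong) (auto simp: Odd_rf_iff)
  also have "\<dots> = - (\<Prod>x\<in>A. f x)"
    using assms(2) by (simp add: prod_uminus)
  finally show ?thesis
    by (simp add: Odd_rf_iff)
qed

lemma map_poly_rf_const_pCons:
  "map_poly rf_const (pCons e p) = pCons (rf_const e) (map_poly rf_const p)"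
  by (rule poly_eqI) (auto simp: coeff_map_poly coeff_pCons split: nat.splits)

lemma poly_sharp_pCons: "poly_sharp (pCons e p) = pCons (cnj e) (- poly_sharp p)"
  by (simp add: poly_sharp_eq_iff poly_poly_sharp)

lemma map_poly_rf_const_uminus: "map_poly rf_const (- p) = - map_poly rf_const p"
  by (rule poly_eqI) (simp add: coeff_map_poly rf_const_uminus)

lemma map_poly_rf_const_mult:
  "map_poly rf_const (p * q) = map_poly rf_const p * map_poly rf_const q"
  unfolding poly_eq_iff coeff_mult coeff_map_poly[of rf_const, OF rf_const_0]
proof
  fix n
  have "rf_const (sum f A) = (\<Sum>i\<in>A. rf_const (f i))" for f and A :: "nat set"
    by (induction A rule: infinite_finite_induct) (auto simp: rf_const_add)
  thus "rf_const (\<Sum>i\<le>n. coeff p i * coeff q (n - i))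
      = (\<Sum>i\<le>n. rf_const (coeff p i) * rf_const (coeff q (n - i)))"
    by (simp add: rf_const_mult)
qed

text \<open>\<open>#\<close> conjugates the coefficients of \<open>p\<close> and replaces
  \<open>g\<close> by \<open>- g\<close>; \<open>poly_sharp\<close> does just this to
  \<open>p\<close> and its variable. The induction follows Horner's scheme.\<close>

lemma rf_sharp_poly_subst:
  assumes "g \<in> Odd_rf"
  shows "rf_sharp (poly (map_poly rf_const p) g) = poly (map_poly rf_const (poly_sharp p)) g"
proof (induction p)
  case (pCons e p)
  thus ?case
    using assms
    by (simp add: poly_sharp_pCons map_poly_rf_const_pCons map_poly_rf_const_uminus Odd_rf_iff)
qed simp

text \<open>When \<open>\<phi>\<close> is constantly a pole of \<open>\<psi>\<close>, the composition has the junk value \<open>0\<close>, which is odd.\<close>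

lemma Odd_rf_comp:
  assumes "\<psi> \<in> Odd_rf" and "\<phi> \<in> Odd_rf"
  shows "rf_comp \<psi> \<phi> \<in> Odd_rf"
proof -
  define p q where "p = fst (quot_of_fract \<psi>)" and "q = snd (quot_of_fract \<psi>)"
  define S where "S r = poly (map_poly rf_const r) \<phi>" for r
  have "q \<noteq> 0" and "\<psi> = Fract p q"
    by (simp_all add: p_def q_def)
  hence "poly_sharp p * q = - (p * poly_sharp q)"
    using assms(1) Odd_rf_Fract_iff by blast
  \<comment> \<open>Substituting \<phi> is a ring homomorphism, so the polynomial identity
    expressing oddness of \<psi> carries over to \<open>S p\<close> and \<open>S q\<close>.\<close>
  hence "S (poly_sharp p * q) = S (- (p * poly_sharp q))"
    by simp
  hence "rf_sharp (S p) * S q = - (S p * rf_sharp (S q))"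
    by (simp add: S_def map_poly_rf_const_mult map_poly_rf_const_uminus
        rf_sharp_poly_subst[OF assms(2)])
  moreover have "rf_sharp (S q) \<noteq> 0" if "S q \<noteq> 0"
    using that rf_sharp_inverse[of "S q"] rf_sharp_mult[of "S q" "inverse (S q)"] by auto
  moreover have comp: "rf_comp \<psi> \<phi> = S p / S q"
    by (simp add: rf_comp_def S_def p_def q_def)
  ultimately have "rf_sharp (rf_comp \<psi> \<phi>) = (- S p) / S q"
    by (cases "S q = 0") (simp_all add: frac_eq_eq del: minus_divide_left[symmetric])
  thus ?thesis
    using comp by (simp add: Odd_rf_iff)
qed

text \<open>The polynomial \<open>d\<close> is the cross-multiplied oddness condition. On the axis,
  away from zeros of \<open>q\<close>, it equals twice the squared modulus of \<open>q\<close> times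
  the real part of \<psi>; conversely, vanishing on the infinite axis forces
  \<open>d = 0\<close>.\<close>

lemma Odd_rf_iff_maps_imaginary_axis: "\<psi> \<in> Odd_rf \<longleftrightarrow> maps_imaginary_axis_to_itself \<psi>"
proof -
  define p q where "p = fst (quot_of_fract \<psi>)" and "q = snd (quot_of_fract \<psi>)"
  define d where "d = poly_sharp p * q + p * poly_sharp q"
  have q: "q \<noteq> 0" and \<psi>: "\<psi> = Fract p q"
    by (simp_all add: p_def q_def)
  have odd: "\<psi> \<in> Odd_rf \<longleftrightarrow> d = 0"
    using q by (simp add: \<psi> Odd_rf_Fract_iff d_def add_eq_0_iff2)
  have sharp: "poly (poly_sharp r) s = cnj (poly r s)" if "Re s = 0" for r s
  proof -
    have "- cnj s = s"
      using that by (simp add: complex_eq_iff)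
    thus ?thesis
      by (simp add: poly_poly_sharp)
  qed
  have d: "poly d s = of_real (2 * (cmod (poly q s))\<^sup>2 * Re (rf_eval \<psi> s))"
    if "Re s = 0" "poly q s \<noteq> 0" for s
  proof -
    have "rf_eval \<psi> s = poly p s / poly q s"
      by (simp add: rf_eval_def p_def q_def)
    hence "poly p s = rf_eval \<psi> s * poly q s"
      using that by simp
    hence "poly d s = (rf_eval \<psi> s + cnj (rf_eval \<psi> s)) * (poly q s * cnj (poly q s))"
      using that by (simp add: d_def sharp algebra_simps)
    thus ?thesis
      by (simp add: complex_add_cnj mult_ac flip: complex_norm_square)
  qed
  show ?thesis
  proof
    assume "\<psi> \<in> Odd_rf"
    hence "d = 0"
      using odd by simp
    thus "maps_imaginary_axis_to_itself \<psi>"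
      unfolding maps_imaginary_axis_to_itself_def using d
      by (auto simp: rf_pole_iff simp flip: q_def simp del: of_real_mult)
  next
    assume imag: "maps_imaginary_axis_to_itself \<psi>"
    have "poly d s = 0" if "Re s = 0" for s
    proof (cases "poly q s = 0")
      \<comment> \<open>At a pole on the axis each summand of \<open>d\<close> contains
        \<open>q\<close> or its conjugate and vanishes.\<close>
      case True
      thus ?thesis
        using that by (simp add: d_def sharp)
    next
      case False
      hence "Re (rf_eval \<psi> s) = 0"
        using imag that by (simp add: maps_imaginary_axis_to_itself_def rf_pole_iff q_def)
      thus ?thesis
        using d[OF that False] by simp
    qed
    hence "range (\<lambda>t::real. \<i> * of_real t) \<subseteq> {s. poly d s = 0}"
      by auto
    moreover have "infinite (range (\<lambda>t::real. \<i> * of_real t))"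
      by (subst finite_image_iff) (auto simp: inj_def infinite_UNIV_char_0)
    ultimately have "d = 0"
      using poly_roots_finite finite_subset by blast
    thus "\<psi> \<in> Odd_rf"
      using odd by simp
  qed
qed

lemma Odd_rf_subset_GP: "Odd_rf \<subseteq> GP"
  unfolding GP_def by (auto simp: Odd_rf_iff_maps_imaginary_axis maps_imaginary_axis_to_itself_def)

subsection \<open>Extraction of factors \<open>h h\<^sup>#\<close>\<close>

text \<open>Reduces membership in \<open>G_plus_closure\<close> to polynomials: a quotient of two
  such polynomials is a member. Zeros on the imaginary axis are allowed, so products of
  \<open>axis_factor\<close> qualify.\<close>

definition left_nonvanishing :: "complex poly \<Rightarrow> bool"
  where "left_nonvanishing p \<longleftrightarrow> (\<forall>s. Re s < 0 \<longrightarrow> poly p s \<noteq> 0)"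

lemma left_nonvanishing_nonzero: "left_nonvanishing p \<Longrightarrow> p \<noteq> 0"
  by (auto simp: left_nonvanishing_def dest: spec[of _ "-1"])

lemma left_nonvanishing_mult:
  "left_nonvanishing p \<Longrightarrow> left_nonvanishing q \<Longrightarrow> left_nonvanishing (p * q)"
  by (simp add: left_nonvanishing_def)

lemma left_nonvanishing_prod:
  "(\<And>x. x \<in> A \<Longrightarrow> left_nonvanishing (f x)) \<Longrightarrow> left_nonvanishing (\<Prod>x\<in>A. f x)"
  by (induction A rule: infinite_finite_induct)
    (auto simp: left_nonvanishing_mult left_nonvanishing_def[of 1])

lemma left_nonvanishing_linear: "0 \<le> Re w \<Longrightarrow> left_nonvanishing [:- w, 1:]"
  by (auto simp: left_nonvanishing_def)

lemma rf_eval_Fract_analytic: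
  assumes "left_nonvanishing q"
  shows "rf_eval (Fract p q) analytic_on {s. Re s < 0}"
proof -
  have "(\<lambda>s. poly p s / poly q s) holomorphic_on {s. Re s < 0}"
    using assms by (intro holomorphic_intros) (auto simp: left_nonvanishing_def)
  hence "rf_eval (Fract p q) holomorphic_on {s. Re s < 0}"
    using assms
    by (rule_tac holomorphic_transform) (auto simp: left_nonvanishing_def rf_eval_Fract(1))
  thus ?thesis
    by (simp add: analytic_on_open open_halfspace_Re_lt)
qed

lemma Fract_in_G_plus_closure:
  assumes "left_nonvanishing p" and "left_nonvanishing q"
  shows "Fract p q \<in> G_plus_closure"
proof -
  have "Fract p q \<noteq> 0"
    using assms left_nonvanishing_nonzero by (simp add: Fract_conv_to_fract)
  thus ?thesis
    using assms by (simp add: G_plus_closure_def rf_eval_Fract_analytic)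
qed

lemma complex_poly_root_factor:
  fixes p :: "complex poly"
  assumes "degree p > 0"
  obtains w q where "p = [:- w, 1:] * q" and "degree q < degree p"
proof -
  have "\<not> constant (poly p)"
    using assms by (simp add: constant_degree)
  then obtain w where "poly p w = 0"
    using fundamental_theorem_of_algebra by blast
  then obtain q where q: "p = [:- w, 1:] * q"
    by (auto simp: poly_eq_0_iff_dvd)
  moreover have "degree p = Suc (degree q)"
    using assms q by (subst q, subst degree_mult_eq) auto
  ultimately show ?thesis
    using that by simp
qed

text \<open>Spectral factorization by induction on the degree: each root in the open left half plane
  is reflected across the imaginary axis.\<close>

lemma sharp_square_left_nonvanishing:
  assumes "p \<noteq> 0"
  obtains q where "left_nonvanishing q" and "q * poly_sharp q = p * poly_sharp p"
  using assms
proof (induction "degree p" arbitrary: p thesis rule: less_induct)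
  case less
  show ?case
  proof (cases "degree p = 0")
    case True
    then obtain c where "p = [:c:]"
      by (rule degree_eq_zeroE)
    with less.prems show ?thesis
      by (intro less.prems(1)[of p]) (auto simp: left_nonvanishing_def)
  next
    case False
    then obtain w r where r: "p = [:- w, 1:] * r" "degree r < degree p"
      using complex_poly_root_factor by blast
    with less.prems have "r \<noteq> 0"
      by auto
    with less.hyps r obtain q where q: "left_nonvanishing q" "q * poly_sharp q = r * poly_sharp r"
      by blast
    obtain l where l: "left_nonvanishing l"
      "l * poly_sharp l = [:- w, 1:] * poly_sharp [:- w, 1:]"
    proof (cases "0 \<le> Re w")
      case True
      thus ?thesis
        using that left_nonvanishing_linear by blast
    next
      case False
      \<comment> \<open>The only root is now \<open>- cnj w\<close>, whose real part is
        positive.\<close>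
      hence "left_nonvanishing (poly_sharp [:- w, 1:])"
        by (auto simp: left_nonvanishing_def poly_poly_sharp)
      thus ?thesis
        using that[of "poly_sharp [:- w, 1:]"] by (simp add: mult.commute del: poly_sharp_simps(3))
    qed
    have "(l * q) * poly_sharp (l * q) = (l * poly_sharp l) * (q * poly_sharp q)"
      by (simp add: mult_ac)
    also have "\<dots> = p * poly_sharp p"
      unfolding l q r(1) by (simp only: poly_sharp_simps mult_ac)
    finally show ?thesis
      using less.prems(1) left_nonvanishing_mult l(1) q(1) by blast
  qed
qed

abbreviation axis_factor :: "real \<Rightarrow> complex poly"
  where "axis_factor t \<equiv> [:- (\<i> * of_real t), 1:]"

lemma poly_sharp_axis_factor: "poly_sharp (axis_factor t) = - axis_factor t"
  by (simp add: poly_sharp_eq_iff)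

lemma left_nonvanishing_axis_prod: "left_nonvanishing (\<Prod>t\<in>T. axis_factor t)"
  by (intro left_nonvanishing_prod left_nonvanishing_linear) simp

lemma poly_sharp_axis_prod:
  "poly_sharp (\<Prod>t\<in>T. axis_factor t) = (-1) ^ card T * (\<Prod>t\<in>T. axis_factor t)"
  unfolding poly_sharp_prod poly_sharp_axis_factor prod_uminus ..

lemma sharp_symmetric_cofactor:
  assumes "p = l * r" and "l \<noteq> 0"
    and "poly_sharp l = l \<or> poly_sharp l = - l" and "poly_sharp p = p \<or> poly_sharp p = - p"
  shows "poly_sharp r = r \<or> poly_sharp r = - r"
proof -
  have "poly_sharp p = poly_sharp l * poly_sharp r"
    by (simp add: assms(1))
  hence "l * poly_sharp r = l * r \<or> l * poly_sharp r = l * (- r)"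
    using assms(1,3,4) by (auto simp: minus_equation_iff)
  thus ?thesis
    unfolding mult_left_cancel[OF assms(2)] .
qed

text \<open>Roots of a symmetric polynomial come in pairs \<open>w, - w\<^sup>*\<close>, each of which contributes
  \<open>-(s - w)(s - w)\<^sup>#\<close>; only the imaginary roots of odd order survive in \<open>T\<close>.\<close>

lemma sharp_symmetric_poly_decomp:
  assumes "p \<noteq> 0" and "poly_sharp p = p \<or> poly_sharp p = - p"
  obtains q c T where "p = q * poly_sharp q * smult c (\<Prod>t\<in>T. axis_factor t)"
    and "finite T" and "c \<noteq> 0"
  using assms
proof (induction "degree p" arbitrary: p thesis rule: less_induct)
  case less
  show ?case
  proof (cases "degree p = 0")
    case True
    then obtain c where "p = [:c:]"
      by (rule degree_eq_zeroE)
    with less.prems show ?thesis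
      by (intro less.prems(1)[of 1 c "{}"]) auto
  next
    case False
    then obtain w r where r: "p = [:- w, 1:] * r" "degree r < degree p"
      using complex_poly_root_factor by blast
    with less.prems have r0: "r \<noteq> 0"
      by auto
    show ?thesis
    proof (cases "Re w = 0")
      case True
      define t where "t = Im w"
      have w: "w = \<i> * of_real t"
        using True by (simp add: complex_eq_iff t_def)
      have "poly_sharp r = r \<or> poly_sharp r = - r"
        using sharp_symmetric_cofactor[OF r(1) _ _ less.prems(3)] poly_sharp_axis_factor[of t]
        unfolding w by simp
      then obtain q c T where IH: "r = q * poly_sharp q * smult c (\<Prod>t\<in>T. axis_factor t)"
        "finite T" "c \<noteq> 0"
        using less.hyps[OF r(2) _ r0] by blast
      \<comment> \<open>One more copy of the root toggles the membership of \<open>t\<close> in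
        \<open>T\<close>. A second copy is absorbed through
        \<open>l * l = - (l * poly_sharp l)\<close>, which turns \<open>c\<close> into
        \<open>- c\<close>.\<close>
      show ?thesis
      proof (cases "t \<in> T")
        case False
        have "p = q * poly_sharp q * smult c (\<Prod>t\<in>insert t T. axis_factor t)"
          unfolding r(1) w IH(1) prod.insert[OF IH(2) False]
          by (simp only: mult_ac mult_smult_right mult_smult_left)
        thus ?thesis
          using less.prems(1) IH(2,3) by blast
      next
        case True
        define l where "l = axis_factor t"
        have "poly_sharp l = - l"
          by (simp add: l_def poly_sharp_axis_factor del: poly_sharp_simps)
        moreover have "p = l * (q * poly_sharp q * smult c (l * (\<Prod>t\<in>T - {t}. axis_factor t)))"
          unfolding r(1) w IH(1) prod.remove[OF IH(2) True] l_def ..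
        ultimately have
          "p = (q * l) * poly_sharp (q * l) * smult (- c) (\<Prod>t\<in>T - {t}. axis_factor t)"
          by (simp add: mult_ac)
        thus ?thesis
          using less.prems(1) IH(2,3) by (metis finite_Diff neg_equal_0_iff_equal)
      qed
    next
      case False
      define l where "l = [:- w, 1:]"
      have ls: "poly_sharp l = - [:cnj w, 1:]"
        unfolding l_def by (rule poly_sharp_linear)
      \<comment> \<open>The root set of \<open>p\<close> is symmetric under reflection, and off the
        axis the reflected root differs from \<open>w\<close>, so it is a root of the cofactor
        \<open>r\<close>.\<close>
      have "poly p w = 0"
        by (simp add: r(1))
      hence "poly (poly_sharp p) (- cnj w) = 0"
        by (simp add: poly_poly_sharp)
      hence "poly p (- cnj w) = 0"
        using less.prems(3) by auto
      moreover have "- w \<noteq> cnj w"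
        using False by (auto simp: complex_eq_iff)
      ultimately have "poly r (- cnj w) = 0"
        unfolding r(1) poly_mult mult_eq_0_iff by auto
      then obtain u where u: "r = [:cnj w, 1:] * u"
        by (auto simp: poly_eq_0_iff_dvd)
      have p: "p = l * poly_sharp l * (- u)"
        unfolding ls r(1) u
        by (simp only: l_def mult_minus_left mult_minus_right minus_minus mult.assoc)
      have u0: "- u \<noteq> 0"
        using r0 u by auto
      have "degree u < degree p"
        using r(2) r0 u0 unfolding u by (subst (asm) degree_mult_eq) auto
      hence deg: "degree (- u) < degree p"
        by simp
      have "l \<noteq> 0"
        by (simp add: l_def)
      hence "l * poly_sharp l \<noteq> 0"
        by simp
      hence "poly_sharp (- u) = - u \<or> poly_sharp (- u) = - (- u)"
        using sharp_symmetric_cofactor[OF p _ _ less.prems(3)] by (simp add: mult.commute)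
      then obtain q c T where IH: "- u = q * poly_sharp q * smult c (\<Prod>t\<in>T. axis_factor t)"
        "finite T" "c \<noteq> 0"
        using less.hyps[OF deg _ u0] by blast
      have "p = (l * q) * poly_sharp (l * q) * smult c (\<Prod>t\<in>T. axis_factor t)"
        unfolding p IH(1) by (simp only: poly_sharp_simps mult_ac)
      thus ?thesis
        using less.prems(1) IH(2,3) by blast
    qed
  qed
qed

subsection \<open>Partial fractions and alternating signs\<close>

lemma degree_prod_linear: "degree (\<Prod>x\<in>A. [:- a x, 1:]) = card A"
  for a :: "'a \<Rightarrow> 'b::field"
  by (subst degree_prod_eq_sum_degree) auto

lemma lead_coeff_prod_linear: "lead_coeff (\<Prod>x\<in>A. [:- a x, 1:]) = 1"
  for a :: "'a \<Rightarrow> 'b::field"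
  by (subst lead_coeff_prod) simp

text \<open>Lagrange interpolation: both sides agree with \<open>p\<close> at the nodes and have
  degree below their number. Dividing by the product of the linear factors gives a partial fraction
  expansion with simple poles.\<close>

lemma mod_prod_linear_eq_lagrange:
  fixes a :: "'a \<Rightarrow> 'b::{field, field_gcd}"
  assumes "finite D" and "inj_on a D"
  shows "p mod (\<Prod>d\<in>D. [:- a d, 1:])
    = (\<Sum>d\<in>D. smult (poly p (a d) / (\<Prod>e\<in>D - {d}. a d - a e)) (\<Prod>e\<in>D - {d}. [:- a e, 1:]))"
    (is "?m = (\<Sum>d\<in>D. ?f d)")
proof (cases "D = {}")
  case False
  define b where "b = (\<Prod>d\<in>D. [:- a d, 1:])"
  have b: "b \<noteq> 0" "degree b = card D"
    using assms(1) by (simp_all add: b_def degree_prod_linear)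
  have card: "0 < card D"
    using assms(1) False by (simp add: card_gt_0_iff)
  show ?thesis
  proof (rule poly_eqI_degree[of "a ` D"])
    fix x assume "x \<in> a ` D"
    then obtain d where d: "d \<in> D" "x = a d"
      by auto
    have "poly b (a d) = 0"
      unfolding b_def poly_prod using assms(1) d by (auto intro!: prod_zero)
    hence "poly (p mod b) (a d) = poly p (a d)"
      by (metis add_0 div_mult_mod_eq mult_zero_right poly_add poly_mult)
    moreover have "poly (?f e) (a d) = (if d = e then poly p (a d) else 0)" if "e \<in> D" for e
    proof (cases "d = e")
      case True
      have "(\<Prod>e\<in>D - {d}. a d - a e) \<noteq> 0"
        using assms d that by (auto simp: inj_on_def)
      thus ?thesis
        using True by (simp add: poly_prod)
    next
      case False
      thus ?thesis
        using assms(1) d by (auto simp: poly_prod intro!: prod_zero)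
    qed
    hence "poly (\<Sum>e\<in>D. ?f e) (a d) = poly p (a d)"
      using assms(1) d by (simp add: poly_sum)
    ultimately show "poly ?m x = poly (\<Sum>e\<in>D. ?f e) x"
      using d by (simp add: b_def)
  next
    show "degree ?m < card (a ` D)"
      using degree_mod_less[OF b(1), of p] b(2) card assms(2) by (auto simp: b_def card_image)
    have "degree (?f d) < card D" if "d \<in> D" for d
      using card_Diff1_less[OF assms(1) that]
      by (intro le_less_trans[OF degree_smult_le]) (simp add: degree_prod_linear)
    thus "degree (\<Sum>d\<in>D. ?f d) < card (a ` D)"
      using card assms(2) by (auto simp: card_image intro: degree_sum_less)
  qed
qed simp

text \<open>Compare degrees and leading coefficients in \<open>p = e * b + m\<close>. The quotient
  supplies the constant and the linear term of the later expansion.\<close>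

lemma div_monic_linear_quotient:
  fixes p b :: "'a::{field, field_gcd} poly"
  assumes "lead_coeff p = 1" and "lead_coeff b = 1" and "degree p \<le> degree b + 1"
  obtains \<alpha> \<beta> where "p div b = [:\<beta>, \<alpha>:]"
    and "\<alpha> = 0 \<or> \<alpha> = 1 \<and> degree p = degree b + 1"
proof (cases "p div b = 0")
  case False
  have b: "b \<noteq> 0"
    using assms(2) by auto
  define e where "e = p div b"
  define m where "m = p mod b"
  have p: "p = e * b + m"
    by (simp add: e_def m_def)
  have deg: "degree (e * b) = degree e + degree b"
    using False b by (simp add: e_def degree_mult_eq)
  have "m = 0 \<or> degree m < degree (e * b)"
    using degree_mod_less[OF b, of p] deg by (auto simp: m_def)
  hence "degree p = degree (e * b)" and "lead_coeff p = lead_coeff (e * b)"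
    unfolding p add.commute[of _ m] by (auto simp: degree_add_eq_right coeff_eq_0)
  hence e: "degree p = degree e + degree b" "lead_coeff e = 1"
    using assms(1,2) deg unfolding lead_coeff_mult by auto
  show ?thesis
  proof (cases "degree e = 0")
    case True
    then obtain \<beta> where "e = [:\<beta>:]"
      by (rule degree_eq_zeroE)
    thus ?thesis
      using that[of \<beta> 0] by (simp add: e_def)
  next
    case False
    hence "degree e = 1"
      using e assms(3) by simp
    then obtain \<alpha> \<beta> where "e = [:\<beta>, \<alpha>:]" "\<alpha> \<noteq> 0"
      by (rule degree1_coeffs)
    thus ?thesis
      using that[of \<beta> \<alpha>] e assms by (simp add: e_def)
  qed
qed (use that[of 0 0] in simp)

text \<open>Counting from the top makes the parity of the rank the sign of the product of the
  differences \<open>t - u\<close>; this parity also selects every other point.\<close>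

definition rank_above :: "'a::linorder set \<Rightarrow> 'a \<Rightarrow> nat"
  where "rank_above T t = card {u \<in> T. t < u}"

lemma sgn_prod_diff:
  fixes t :: "'a::linordered_idom"
  assumes "finite T"
  shows "sgn (\<Prod>u\<in>T - {t}. t - u) = (-1) ^ rank_above T t"
proof -
  have "sgn (\<Prod>u\<in>T - {t}. t - u) = (\<Prod>u\<in>T - {t}. sgn (t - u))"
    using assms by (induction T rule: infinite_finite_induct) (simp_all add: insert_Diff_if sgn_mult)
  also have "\<dots> = (\<Prod>u\<in>T - {t}. if t < u then -1 else 1)"
    by (intro prod.cong) auto
  also have "\<dots> = (-1) ^ card ((T - {t}) \<inter> {u. t < u})"
    using assms by (simp add: prod.If_cases)
  also have "(T - {t}) \<inter> {u. t < u} = {u \<in> T. t < u}"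
    by auto
  finally show ?thesis
    by (simp add: rank_above_def)
qed

text \<open>Adding a new minimum \<open>b\<close> leaves the other ranks unchanged and gives
  \<open>b\<close> the rank \<open>card A\<close>. Halves are rounded up because the topmost point
  has rank 0.\<close>

lemma card_even_rank_above:
  assumes "finite T"
  shows "card {t \<in> T. even (rank_above T t)} = (card T + 1) div 2"
  using assms
proof (induction T rule: finite_linorder_min_induct)
  case (insert b A)
  have b: "b \<notin> A"
    using insert by auto
  have "rank_above (insert b A) t = rank_above A t" if "t \<in> A" for t
    unfolding rank_above_def using insert that by (intro arg_cong[of _ _ card]) auto
  moreover have "{u \<in> insert b A. b < u} = A"
    using insert by auto
  hence "rank_above (insert b A) b = card A"
    by (simp add: rank_above_def)
  ultimately have "{t \<in> insert b A. even (rank_above (insert b A) t)}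
      = (if even (card A) then {b} else {}) \<union> {t \<in> A. even (rank_above A t)}"
    by auto
  thus ?case
    using insert b by (auto simp: card_insert_if elim!: evenE oddE)
qed simp

lemma card_odd_rank_above:
  assumes "finite T"
  shows "card {t \<in> T. odd (rank_above T t)} = card T div 2"
proof -
  have "card T = card {t \<in> T. even (rank_above T t)} + card {t \<in> T. odd (rank_above T t)}"
    using assms by (subst card_Un_disjoint[symmetric]) (auto intro: arg_cong[of _ _ card])
  thus ?thesis
    using card_even_rank_above[OF assms] by linarith
qed

subsection \<open>Interlacing zeros and poles\<close>

lemma to_fract_smult: "to_fract (smult c p) = rf_const c * to_fract p"
  by (simp add: rf_const_def flip: to_fract_mult)

lemma to_fract_linear: "to_fract [:- w, 1:] = rf_var - rf_const w"
  by (simp add: rf_var_def rf_const_def flip: to_fract_diff)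

lemma to_fract_pCons2: "to_fract [:\<beta>, \<alpha>:] = rf_const \<beta> + rf_const \<alpha> * rf_var"
  by (simp add: rf_var_def rf_const_def flip: to_fract_add to_fract_mult)

lemma to_fract_in_Odd_rf_iff: "to_fract p \<in> Odd_rf \<longleftrightarrow> poly_sharp p = - p"
  by (simp add: Odd_rf_iff rf_sharp_to_fract flip: to_fract_uminus)

lemma Odd_rf_const_iff: "rf_const c \<in> Odd_rf \<longleftrightarrow> Re c = 0"
  by (auto simp: Odd_rf_iff complex_eq_iff simp flip: rf_const_uminus)

lemma Odd_rf_var: "rf_var \<in> Odd_rf"
  by (simp add: Odd_rf_iff)

lemma Odd_rf_simple_pole:
  "rf_const (of_real a) / (rf_var - rf_const (\<i> * of_real r)) \<in> Odd_rf"
  unfolding divide_inverse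
  by (intro Odd_rf_scale Odd_rf_inverse) (simp add: Odd_rf_iff rf_const_uminus)

text \<open>The simple zeros of \<open>P\<close> on the imaginary axis are turned alternately into poles and zeros by
  dividing by \<open>B B\<^sup>#\<close>, where \<open>B\<close> takes every other one of them. Interlacing makes all residues have
  the same sign; whether the topmost point becomes a zero or a pole decides which sign that is.\<close>

lemma odd_simple_axis_zeros_decomp:
  fixes c :: complex and T :: "real set"
  defines "P \<equiv> smult c (\<Prod>t\<in>T. axis_factor t)"
  assumes fin: "finite T" and c: "c \<noteq> 0" and odd: "to_fract P \<in> Odd_rf"
  obtains D r0 a0 a where "finite D" and "0 \<le> a0" and "\<And>d. d \<in> D \<Longrightarrow> 0 < a d"
    and "to_fract P = to_fract (\<Prod>d\<in>D. axis_factor d)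
      * (rf_const (\<i> * of_real r0) + rf_const (of_real a0) * rf_var
          + (\<Sum>d\<in>D. rf_const (of_real (a d)) / (rf_var - rf_const (\<i> * of_real d))))
      * rf_sharp (to_fract (\<Prod>d\<in>D. axis_factor d))"
proof -
  have ii: "\<i> ^ n * \<i> ^ n = (-1) ^ n" for n
    by (simp flip: power_mult_distrib)
  define k where "k = card T"
  have "smult (cnj c * (-1) ^ k) (\<Prod>t\<in>T. axis_factor t) = smult (- c) (\<Prod>t\<in>T. axis_factor t)"
    using odd unfolding to_fract_in_Odd_rf_iff P_def poly_sharp_simps poly_sharp_axis_prod k_def
    by (cases "even (card T)") simp_all
  hence cc: "cnj c * (-1) ^ k = - c"
    by (drule_tac arg_cong[of _ _ lead_coeff])
      (simp only: lead_coeff_smult lead_coeff_prod_linear mult_1_right)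
  \<comment> \<open>At \<open>s = \<i> * x\<close> the polynomial \<open>P\<close> is
    \<open>c * \<i> ^ k\<close> times the product of the \<open>x - t\<close>. Oddness makes this
    constant purely imaginary, and \<gamma> is its imaginary part.\<close>
  define \<gamma> where "\<gamma> = Re (c * \<i> ^ k / \<i>)"
  have "cnj (c * \<i> ^ k / \<i>) = - (cnj c * (-1) ^ k) * \<i> ^ k / \<i>"
    by (simp add: power_minus[of \<i>])
  hence "Im (c * \<i> ^ k / \<i>) = 0"
    unfolding cc minus_minus by (metis Reals_cnj_iff complex_is_Real_iff)
  hence "c * \<i> ^ k / \<i> = of_real \<gamma>"
    by (simp add: complex_eq_iff \<gamma>_def)
  hence \<gamma>: "c * \<i> ^ k = of_real \<gamma> * \<i>"
    by (subst (asm) nonzero_divide_eq_eq) auto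
  have \<gamma>0: "\<gamma> \<noteq> 0"
    using c \<gamma> by auto

  \<comment> \<open>These are the future poles: odd ranks for positive \<gamma>, even ranks for
    negative \<gamma>. The sign of \<open>\<rho> d\<close> below is given by the parity of the rank,
    so this choice makes \<open>- \<gamma> * \<rho> d\<close> positive.\<close>
  define D where "D = {t \<in> T. even (rank_above T t) \<longleftrightarrow> \<gamma> < 0}"
  define N where "N = T - D"
  have fins: "finite D" "finite N" and "D \<subseteq> T"
    using fin by (auto simp: D_def N_def)
  have card: "k = card D + card N"
    unfolding k_def N_def using fins(1) \<open>D \<subseteq> T\<close> fin by (simp add: card_Diff_subset card_mono)
  \<comment> \<open>It follows that \<open>N\<close> can have one point more than \<open>D\<close>
    only when \<gamma> is positive, which makes the linear coefficient nonnegative.\<close>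
  have cardD: "card D = (if \<gamma> < 0 then (k + 1) div 2 else k div 2)"
    using card_even_rank_above[OF fin] card_odd_rank_above[OF fin] by (simp add: D_def k_def)
  define A where "A = (\<Prod>t\<in>N. axis_factor t)"
  define B where "B = (\<Prod>t\<in>D. axis_factor t)"
  have AB: "P = smult c (A * B)"
    unfolding P_def A_def B_def N_def using prod.subset_diff[OF \<open>D \<subseteq> T\<close> fin] by metis
  have B0: "B \<noteq> 0"
    using fins by (simp add: B_def)
  have deg: "degree A = card N" "degree B = card D"
    by (simp_all add: A_def B_def degree_prod_linear)
  have "lead_coeff A = 1" and "lead_coeff B = 1"
    unfolding A_def B_def by (rule lead_coeff_prod_linear)+
  moreover have "degree A \<le> degree B + 1"
    using card cardD unfolding deg by (auto split: if_splits)
  ultimately obtain \<alpha> \<beta> where AdivB: "A div B = [:\<beta>, \<alpha>:]" and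
    \<alpha>: "\<alpha> = 0 \<or> \<alpha> = 1 \<and> card N = card D + 1"
    unfolding deg[symmetric] by (rule div_monic_linear_quotient)
  \<comment> \<open>The residue at \<open>d\<close> of the real quotient with zeros \<open>N\<close>
    and poles \<open>D\<close>.\<close>
  define \<rho> where "\<rho> d = (\<Prod>n\<in>N. d - n) / (\<Prod>e\<in>D - {d}. d - e)" for d
  have \<rho>: "0 < - \<gamma> * \<rho> d" if "d \<in> D" for d
  proof -
    \<comment> \<open>A quotient and a product of nonzero reals have the same sign, so
      \<open>\<rho> d\<close> has the sign of the full product over \<open>T - {d}\<close>.\<close>
    have "T - {d} = N \<union> (D - {d})" and "N \<inter> (D - {d}) = {}"
      using that \<open>D \<subseteq> T\<close> by (auto simp: N_def)
    hence "(\<Prod>n\<in>T - {d}. d - n) = (\<Prod>n\<in>N. d - n) * (\<Prod>e\<in>D - {d}. d - e)"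
      using fins by (simp add: prod.union_disjoint)
    hence "sgn (\<rho> d) = (-1) ^ rank_above T d"
      using sgn_prod_diff[OF fin, of d] by (simp add: \<rho>_def sgn_mult sgn_divide)
    also have "\<dots> = - sgn \<gamma>"
      using that \<gamma>0 by (auto simp: D_def)
    finally have "sgn (- \<gamma> * \<rho> d) = 1"
      using \<gamma>0 by (simp add: sgn_mult)
    thus ?thesis
      by (simp only: sgn_1_pos)
  qed

  \<comment> \<open>The factor compensates the sign in
    \<open>poly_sharp B = (-1) ^ card D * B\<close>, so that \<open>P\<close> becomes
    \<open>B\<close> times \<open>R\<close> times the sharp of \<open>B\<close>.\<close>
  define c0 where "c0 = c * (-1) ^ card D"
  define R where "R = rf_const c0 * to_fract A / to_fract B"
  have sharpB: "rf_sharp (to_fract B) = rf_const ((-1) ^ card D) * to_fract B"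
    unfolding B_def rf_sharp_to_fract poly_sharp_axis_prod
    by (simp add: minus_one_power_iff rf_const_uminus)
  have tB0: "to_fract B \<noteq> 0"
    using B0 by simp
  have "to_fract B * R * rf_sharp (to_fract B)
      = rf_const (c0 * (-1) ^ card D) * to_fract A * to_fract B"
    unfolding R_def sharpB rf_const_mult using tB0 by (simp add: mult_ac)
  also have "c0 * (-1) ^ card D = c"
    by (simp add: c0_def mult.assoc flip: power_mult_distrib)
  finally have PR: "to_fract P = to_fract B * R * rf_sharp (to_fract B)"
    by (simp only: AB to_fract_smult to_fract_mult mult.assoc)

  have res: "c0 * (poly A (\<i> * of_real d) / (\<Prod>e\<in>D - {d}. \<i> * of_real d - \<i> * of_real e))
      = of_real (- \<gamma> * \<rho> d)" if d: "d \<in> D" for d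
  proof -
    obtain m where m: "card D = Suc m"
      using card_Suc_Diff1[OF fins(1) d] by metis
    hence "card (D - {d}) = m"
      using d fins by simp
    moreover have "poly A (\<i> * of_real d) = (\<Prod>n\<in>N. \<i> * of_real (d - n))"
      by (simp add: A_def poly_prod algebra_simps)
    moreover have "(\<Prod>e\<in>D - {d}. \<i> * of_real d - \<i> * of_real e) = (\<Prod>e\<in>D - {d}. \<i> * of_real (d - e))"
      by (simp add: algebra_simps)
    ultimately have "poly A (\<i> * of_real d) / (\<Prod>e\<in>D - {d}. \<i> * of_real d - \<i> * of_real e)
        = \<i> ^ card N / \<i> ^ m * of_real (\<rho> d)"
      by (simp only: prod.distrib prod_constant \<rho>_def of_real_divide of_real_prod) simp
    \<comment> \<open>The denominator has \<open>card D - 1\<close> factors, so one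
      \<open>\<i>\<close> is left over; with the \<open>\<i>\<close> in
      \<open>c * \<i> ^ k = \<gamma> * \<i>\<close> it produces the minus sign.\<close>
    moreover have "c0 * (\<i> ^ card N / \<i> ^ m) = of_real (- \<gamma>)"
    proof -
      have "c0 * (\<i> ^ card N / \<i> ^ m) * \<i> ^ m = c * \<i> ^ card N * (-1) ^ card D"
        by (simp add: c0_def)
      also have "\<dots> = c * \<i> ^ k * \<i> ^ card D"
        unfolding ii[symmetric] card by (simp add: power_add)
      also have "\<dots> = of_real (- \<gamma>) * \<i> ^ m"
        unfolding \<gamma> m by (simp add: mult.assoc)
      finally show ?thesis
        by simp
    qed
    ultimately show ?thesis
      by (simp only: of_real_mult flip: mult.assoc)
  qed

  define a0 where "a0 = (if \<alpha> = 0 then 0 else \<gamma>)"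
  have a0: "c0 * \<alpha> = of_real a0" and "0 \<le> a0"
  proof -
    \<comment> \<open>In this case \<open>k = 2 * card D + 1\<close>, hence
      \<open>c0 * \<i> = c * \<i> ^ k\<close>.\<close>
    have "c0 = of_real \<gamma>" and "0 < \<gamma>" if "card N = card D + 1"
    proof -
      have "c0 * \<i> = c * (\<i> ^ card D * \<i> ^ card D) * \<i>"
        by (simp add: c0_def ii)
      also have "\<dots> = c * \<i> ^ k"
        by (simp add: card that power_add)
      finally show "c0 = of_real \<gamma>"
        by (simp add: \<gamma>)
      show "0 < \<gamma>"
        using card cardD that \<gamma>0 by (auto split: if_splits)
    qed
    thus "c0 * \<alpha> = of_real a0" and "0 \<le> a0"
      using \<alpha> by (auto simp: a0_def)
  qed

  define \<Sigma> where
    "\<Sigma> = (\<Sum>d\<in>D. rf_const (of_real (- \<gamma> * \<rho> d)) / (rf_var - rf_const (\<i> * of_real d)))"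
  have inj: "inj_on (\<lambda>d. \<i> * complex_of_real d) D"
    by (simp add: inj_on_def)
  define M where "M = A mod B"
  have "A = B * [:\<beta>, \<alpha>:] + M"
    unfolding M_def AdivB[symmetric] by (rule mult_div_mod_eq[symmetric])
  hence "R = rf_const c0 * (to_fract B * to_fract [:\<beta>, \<alpha>:] + to_fract M) / to_fract B"
    by (simp only: R_def to_fract_add to_fract_mult)
  also have "\<dots> = rf_const c0 * to_fract [:\<beta>, \<alpha>:] + rf_const c0 * to_fract M / to_fract B"
    using tB0 by (simp add: distrib_left add_divide_distrib)
  also have "rf_const c0 * to_fract M / to_fract B = \<Sigma>"
    unfolding M_def B_def mod_prod_linear_eq_lagrange[OF fins(1) inj] to_fract_sum sum_distrib_left
      sum_divide_distrib \<Sigma>_def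
  proof (rule sum.cong)
    fix d assume d: "d \<in> D"
    have "to_fract (\<Prod>e\<in>D. axis_factor e)
        = (rf_var - rf_const (\<i> * of_real d)) * to_fract (\<Prod>e\<in>D - {d}. axis_factor e)"
      unfolding prod.remove[OF fins(1) d] to_fract_mult to_fract_linear ..
    moreover have "to_fract (\<Prod>e\<in>D - {d}. axis_factor e) \<noteq> 0"
      using fins by simp
    ultimately show "rf_const c0 * to_fract (smult
          (poly A (\<i> * of_real d) / (\<Prod>e\<in>D - {d}. \<i> * of_real d - \<i> * of_real e))
          (\<Prod>e\<in>D - {d}. axis_factor e)) / to_fract (\<Prod>d\<in>D. axis_factor d)
        = rf_const (of_real (- \<gamma> * \<rho> d)) / (rf_var - rf_const (\<i> * of_real d))"
      unfolding res[OF d, symmetric] to_fract_smult rf_const_mult by simp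
  qed simp
  also have "rf_const c0 * to_fract [:\<beta>, \<alpha>:] = rf_const (c0 * \<beta>) + rf_const (of_real a0) * rf_var"
    unfolding a0[symmetric] rf_const_mult to_fract_pCons2 by (simp add: algebra_simps)
  finally have R: "R = rf_const (c0 * \<beta>) + rf_const (of_real a0) * rf_var + \<Sigma>" .

  \<comment> \<open>\<open>R\<close> inherits oddness from \<open>P\<close> because the factor
    formed by \<open>B\<close> and its sharp is fixed by \<open>#\<close>. Removing the odd linear
    and polar terms leaves an odd constant, which is purely imaginary.\<close>
  have "to_fract B * rf_sharp (to_fract B) \<noteq> 0"
    using B0 by (simp add: rf_sharp_to_fract)
  moreover have "rf_sharp (rf_sharp (to_fract B)) = to_fract B"
    by (simp add: rf_sharp_to_fract)
  hence "to_fract B * rf_sharp (to_fract B) * rf_sharp R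
      = to_fract B * rf_sharp (to_fract B) * (- R)"
    using odd unfolding PR by (simp add: Odd_rf_iff mult_ac)
  ultimately have "R \<in> Odd_rf"
    by (subst (asm) mult_left_cancel) (auto simp: Odd_rf_iff)
  moreover have "\<Sigma> \<in> Odd_rf"
    unfolding \<Sigma>_def by (intro Odd_rf_sum Odd_rf_simple_pole)
  moreover have "rf_const (of_real a0) * rf_var \<in> Odd_rf"
    by (intro Odd_rf_scale Odd_rf_var)
  ultimately have "rf_const (c0 * \<beta>) \<in> Odd_rf"
    unfolding R by (simp add: Odd_rf_iff)
  hence "c0 * \<beta> = \<i> * of_real (Im (c0 * \<beta>))"
    unfolding Odd_rf_const_iff by (simp add: complex_eq_iff)
  then obtain r0 where r0: "c0 * \<beta> = \<i> * of_real r0" ..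
  show ?thesis
    by (rule that[OF fins(1) \<open>0 \<le> a0\<close> \<rho> PR[unfolded R r0 \<Sigma>_def B_def]])
qed

section \<open>Assembling the factorization of an odd function\<close>

lemma Odd_rf_factorization:
  assumes "\<psi> \<in> Odd_rf"
  shows "\<exists>g\<in>G_plus_closure. \<exists>(r0::real) (a0::real) (n::nat) (a :: nat \<Rightarrow> real) (r :: nat \<Rightarrow> real).
    a0 \<ge> 0 \<and> (\<forall>j\<in>{1..n}. a j > 0) \<and>
    \<psi> = g * (rf_const (\<i> * of_real r0) + rf_const (of_real a0) * rf_var
               + (\<Sum>j=1..n. rf_const (of_real (a j)) / (rf_var - rf_const (\<i> * of_real (r j)))))
          * rf_sharp g"
proof (cases "\<psi> = 0")
  case True
  have "1 \<in> G_plus_closure"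
    using Fract_in_G_plus_closure[of 1 1] by (simp add: left_nonvanishing_def One_fract_def)
  moreover have "(0::rat_fun) = 1 * (rf_const (\<i> * of_real 0) + rf_const (of_real 0) * rf_var
      + (\<Sum>j=1..(0::nat). rf_const (of_real 1) / (rf_var - rf_const (\<i> * of_real 0)))) * rf_sharp 1"
    by simp
  ultimately show ?thesis
    unfolding True by (intro bexI[of _ 1] exI[of _ 0] exI[of _ "\<lambda>_. 1"] exI[of _ "\<lambda>_. 0"]) auto
next
  case False
  define p q where "p = fst (quot_of_fract \<psi>)" and "q = snd (quot_of_fract \<psi>)"
  have q: "q \<noteq> 0" and \<psi>: "\<psi> = Fract p q"
    by (simp_all add: p_def q_def)
  \<comment> \<open>The numerator of \<psi> over \<open>q * poly_sharp q\<close>. This denominator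
    is fixed by \<open>poly_sharp\<close>, so oddness of \<psi> becomes
    \<open>poly_sharp P = - P\<close>.\<close>
  define P where "P = p * poly_sharp q"
  have "p \<noteq> 0"
    using False \<psi> q by (auto simp: Fract_conv_to_fract)
  hence "P \<noteq> 0"
    using q by (simp add: P_def)
  moreover have "poly_sharp P = - P"
    using assms q unfolding \<psi> Odd_rf_Fract_iff[OF q] by (simp add: P_def)
  ultimately obtain v c T where P: "P = v * poly_sharp v * smult c (\<Prod>t\<in>T. axis_factor t)"
    and T: "finite T" "c \<noteq> 0"
    using sharp_symmetric_poly_decomp[of P] by blast
  have v0: "v \<noteq> 0"
    using P \<open>P \<noteq> 0\<close> by auto
  \<comment> \<open>Reflecting roots makes \<open>v\<close> and \<open>q\<close> zero-free in the
    open left half plane without changing the products with their sharps.\<close>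
  obtain u where u: "left_nonvanishing u" "u * poly_sharp u = v * poly_sharp v"
    using sharp_square_left_nonvanishing[OF v0] .
  obtain w where w: "left_nonvanishing w" "w * poly_sharp w = q * poly_sharp q"
    using sharp_square_left_nonvanishing[OF q] .
  define L where "L = smult c (\<Prod>t\<in>T. axis_factor t)"
  have PL: "P = v * poly_sharp v * L"
    by (simp add: P L_def)
  have "v * poly_sharp v * poly_sharp L = v * poly_sharp v * (- L)"
    using \<open>poly_sharp P = - P\<close> unfolding PL by (simp add: mult_ac)
  hence "poly_sharp L = - L"
    using v0 by (subst (asm) mult_left_cancel) auto
  hence "to_fract L \<in> Odd_rf"
    by (simp add: to_fract_in_Odd_rf_iff)
  then obtain D r0 a0 a where D: "finite D" "0 \<le> a0" "\<And>d. d \<in> D \<Longrightarrow> 0 < a d"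
    and L: "to_fract L = to_fract (\<Prod>d\<in>D. axis_factor d)
      * (rf_const (\<i> * of_real r0) + rf_const (of_real a0) * rf_var
          + (\<Sum>d\<in>D. rf_const (of_real (a d)) / (rf_var - rf_const (\<i> * of_real d))))
      * rf_sharp (to_fract (\<Prod>d\<in>D. axis_factor d))"
    unfolding L_def by (rule odd_simple_axis_zeros_decomp[OF T]) (rule that[unfolded L_def])
  define B where "B = (\<Prod>d\<in>D. axis_factor d)"
  define F where "F = rf_const (\<i> * of_real r0) + rf_const (of_real a0) * rf_var
      + (\<Sum>d\<in>D. rf_const (of_real (a d)) / (rf_var - rf_const (\<i> * of_real d)))"
  \<comment> \<open>\<open>u\<close> comes from the square part of the numerator, \<open>w\<close>
    from the denominator, and \<open>B\<close> cancels the axis poles created in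
    \<open>F\<close>.\<close>
  define g where "g = Fract (u * B) w"
  have g: "g \<in> G_plus_closure"
    unfolding g_def B_def
    by (intro Fract_in_G_plus_closure left_nonvanishing_mult left_nonvanishing_axis_prod u(1) w(1))
  have "\<psi> = to_fract P / to_fract (q * poly_sharp q)"
    using q by (simp add: \<psi> P_def Fract_conv_to_fract)
  also have "\<dots> = to_fract (u * poly_sharp u) * to_fract L / to_fract (w * poly_sharp w)"
    by (simp only: PL u(2) w(2) to_fract_mult)
  also have "\<dots> = g * F * rf_sharp g"
    unfolding L g_def Fract_conv_to_fract F_def[symmetric] B_def[symmetric]
    by (simp add: rf_sharp_to_fract mult_ac)
  finally have \<psi>F: "\<psi> = g * F * rf_sharp g" .
  \<comment> \<open>Enumerating \<open>D\<close> turns the sum over poles into one over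
    \<open>{1..card D}\<close>.\<close>
  obtain r where r: "bij_betw r {1..card D} D"
    using ex_bij_betw_nat_finite_1[OF D(1)] by blast
  have F: "F = rf_const (\<i> * of_real r0) + rf_const (of_real a0) * rf_var
      + (\<Sum>j=1..card D. rf_const (of_real (a (r j))) / (rf_var - rf_const (\<i> * of_real (r j))))"
    unfolding F_def sum.reindex_bij_betw[OF r, symmetric] ..
  have "\<forall>j\<in>{1..card D}. a (r j) > 0"
    using D(3) r by (auto dest: bij_betwE)
  thus ?thesis
    using g \<psi>F D(2) unfolding F
    by (intro bexI[of _ g] exI[of _ r0] exI[of _ a0] exI[of _ "card D"] exI[of _ "\<lambda>j. a (r j)"]
        exI[of _ r] conjI)
qed

theorem proposition4p2:
  shows
    "Odd_rf = GP \<inter> Odd_rf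
     \<and> (\<forall>\<psi>. \<psi> \<in> Odd_rf \<longleftrightarrow> maps_imaginary_axis_to_itself \<psi>)
     \<and> ((\<forall>\<psi>\<in>Odd_rf. \<forall>c::real. rf_const (of_real c) * \<psi> \<in> Odd_rf)
        \<and> (\<forall>\<psi>\<in>Odd_rf. \<forall>\<phi>\<in>Odd_rf. \<psi> + \<phi> \<in> Odd_rf)
        \<and> (\<forall>\<psi>\<in>Odd_rf. \<psi> \<noteq> 0 \<longrightarrow> inverse \<psi> \<in> Odd_rf)
        \<and> (\<forall>\<psi>\<in>Odd_rf. \<forall>\<phi>\<in>Odd_rf. rf_comp_defined \<psi> \<phi> \<longrightarrow> rf_comp \<psi> \<phi> \<in> Odd_rf)
        \<and> (\<forall>(m::nat) (\<Psi> :: nat \<Rightarrow> rat_fun).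
              (\<forall>j\<in>{1..2 * m + 1}. \<Psi> j \<in> Odd_rf) \<longrightarrow> (\<Prod>j=1..2 * m + 1. \<Psi> j) \<in> Odd_rf))
     \<and> (\<forall>\<psi>\<in>Odd_rf. \<exists>g\<in>G_plus_closure. \<exists>(r0::real) (a0::real) (n::nat) (a :: nat \<Rightarrow> real) (r :: nat \<Rightarrow> real).
          a0 \<ge> 0 \<and> (\<forall>j\<in>{1..n}. a j > 0) \<and>
          \<psi> = g * (rf_const (\<i> * of_real r0) + rf_const (of_real a0) * rf_var
                     + (\<Sum>j=1..n. rf_const (of_real (a j)) / (rf_var - rf_const (\<i> * of_real (r j)))))
                * rf_sharp g)"
proof (intro conjI allI ballI impI Odd_rf_factorization)
  show "Odd_rf = GP \<inter> Odd_rf"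
    using Odd_rf_subset_GP by blast
  show "(\<Prod>j=1..2 * m + 1. \<Psi> j) \<in> Odd_rf" if "\<forall>j\<in>{1..2 * m + 1}. \<Psi> j \<in> Odd_rf"
    for m and \<Psi> :: "nat \<Rightarrow> rat_fun"
    using that by (intro Odd_rf_prod) auto
qed (auto intro: Odd_rf_iff_maps_imaginary_axis Odd_rf_scale Odd_rf_add Odd_rf_inverse Odd_rf_comp
    simp: Odd_rf_iff_maps_imaginary_axis[symmetric])

end
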